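(* Let $(T,\eta,\mu)$ be a monad on a category $\mathsf{C}$, let $(A,e)$ be a $T$-algebra, and let $S$ be an object of $\mathsf{C}$. The set $\mathsf{C}(S,TA)$ equipped with the partial evaluation relation $\to$ is an abstract reduction system with the following properties: (1) Reflexivity: for each $s\in\mathsf{C}(S,TA)$, $s\to s$. (2) Confluence: if $s,t,u\in\mathsf{C}(S,TA)$ satisfy $s\to t$ and $s\to u$, then there exists $z\in\mathsf{C}(S,TA)$ such that $t\to z$ and $u\to z$. In particular, $z$ can always be given by $\eta_A\circ e\circ t=\eta_A\circ e\circ u$. (3) If $T$ is weakly cartesian, then $\to$ is transitive.
   Context: An abstract reduction system is a set equipped with a binary relation, called the reduction relation. A monad $(T,\eta,\mu)$ on $\mathsf{C}$ has unit $\eta:\mathrm{id}_{\mathsf{C}}\Rightarrow T$ and multiplication $\mu:TT\Rightarrow T$. A $T$-algebra is an object $A$ with a morphism $e:TA\to A$ such that $e\circ\eta_A=\mathrm{id}_A$ and $e\circ Te=e\circ\mu_A$. For morphisms $p,q:S\to TA$, a partial evaluation of $p$ into $q$ is a morphism $k:S\to TTA$ such that $\mu_A\circ k=p$ and $(Te)\circ k=q$. The partial evaluation relation on the set $\mathsf{C}(S,TA)$ of morphisms $S\to TA$ is: $p\to q$ if and only if there exists a partial evaluation of $p$ into $q$. A commuting square with $f:A'\to B$, $g:A'\to C$, $m:B\to D$, $n:C\to D$, $m\circ f=n\circ g$, is a weak pullback if for every object $S'$ and all morphisms $b:S'\to B$, $c:S'\to C$ with $m\circ b=n\circ c$ there exists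 a (not necessarily unique) morphism $a:S'\to A'$ with $f\circ a=b$ and $g\circ a=c$. The monad $(T,\eta,\mu)$ is weakly cartesian if the functor $T$ preserves weak pullbacks (it sends weak pullback squares to weak pullback squares) and all naturality squares of $\eta$ and of $\mu$ are weak pullbacks. *)

theory Defs
  imports Main
begin

record ('o, 'm) cat =
  Obj :: "'o set"
  Arr :: "'m set"
  Dom :: "'m \<Rightarrow> 'o"
  Cod :: "'m \<Rightarrow> 'o"
  Ident :: "'o \<Rightarrow> 'm"
  Comp :: "'m \<Rightarrow> 'm \<Rightarrow> 'm"  (infixr "\<cdot>\<index>" 70)

definition Hom :: "('o, 'm, 'z) cat_scheme \<Rightarrow> 'o \<Rightarrow> 'o \<Rightarrow> 'm set" where
  "Hom C X Y = {f \<in> Arr C. Dom C f = X \<and> Cod C f = Y}"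

text \<open>Composition is in applicative order: \<open>g \<cdot> f\<close> means \<open>f\<close> first. Nothing is assumed about
  \<open>Comp\<close>, \<open>Dom\<close> and \<open>Cod\<close> outside \<open>Arr\<close>, nor about non-composable pairs.\<close>

locale category =
  fixes C :: "('o, 'm, 'z) cat_scheme" (structure)
  assumes Dom_in_Obj: "f \<in> Arr C \<Longrightarrow> Dom C f \<in> Obj C"
    and Cod_in_Obj: "f \<in> Arr C \<Longrightarrow> Cod C f \<in> Obj C"
    and Ident_in_Hom: "X \<in> Obj C \<Longrightarrow> Ident C X \<in> Hom C X X"
    and Comp_in_Hom: "f \<in> Hom C X Y \<Longrightarrow> g \<in> Hom C Y Z \<Longrightarrow> g \<cdot> f \<in> Hom C X Z"
    and Comp_Ident: "f \<in> Hom C X Y \<Longrightarrow> f \<cdot> Ident C X = f"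
    and Ident_Comp: "f \<in> Hom C X Y \<Longrightarrow> Ident C Y \<cdot> f = f"
    and Comp_assoc:
      "f \<in> Hom C W X \<Longrightarrow> g \<in> Hom C X Y \<Longrightarrow> h \<in> Hom C Y Z \<Longrightarrow> (h \<cdot> g) \<cdot> f = h \<cdot> (g \<cdot> f)"

record ('o, 'm, 'p, 'n) functor_data =
  omap :: "'o \<Rightarrow> 'p"
  amap :: "'m \<Rightarrow> 'n"

locale functor_between = source: category C + target: category D
  for C :: "('o, 'm, 'y) cat_scheme" and D :: "('p, 'n, 'z) cat_scheme"
    and F :: "('o, 'm, 'p, 'n) functor_data" +
  assumes omap_in_Obj: "X \<in> Obj C \<Longrightarrow> omap F X \<in> Obj D"
    and amap_in_Hom: "f \<in> Hom C X Y \<Longrightarrow> amap F f \<in> Hom D (omap F X) (omap F Y)"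
    and amap_Ident: "X \<in> Obj C \<Longrightarrow> amap F (Ident C X) = Ident D (omap F X)"
    and amap_Comp: "f \<in> Hom C X Y \<Longrightarrow> g \<in> Hom C Y Z \<Longrightarrow>
      amap F (g \<cdot>\<^bsub>C\<^esub> f) = amap F g \<cdot>\<^bsub>D\<^esub> amap F f"

definition id_functor :: "('o, 'm, 'o, 'm) functor_data" where
  "id_functor = \<lparr>omap = (\<lambda>X. X), amap = (\<lambda>f. f)\<rparr>"

definition comp_functor ::
    "('p, 'n, 'q, 'l) functor_data \<Rightarrow> ('o, 'm, 'p, 'n) functor_data \<Rightarrow>
     ('o, 'm, 'q, 'l) functor_data" where
  "comp_functor G F = \<lparr>omap = omap G \<circ> omap F, amap = amap G \<circ> amap F\<rparr>"

locale natural_transformation =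
  F: functor_between C D F + G: functor_between C D G
  for C :: "('o, 'm, 'y) cat_scheme" and D :: "('p, 'n, 'z) cat_scheme"
    and F :: "('o, 'm, 'p, 'n) functor_data" and G :: "('o, 'm, 'p, 'n) functor_data"
    and \<tau> :: "'o \<Rightarrow> 'n" +
  assumes component_in_Hom: "X \<in> Obj C \<Longrightarrow> \<tau> X \<in> Hom D (omap F X) (omap G X)"
    and naturality: "f \<in> Hom C X Y \<Longrightarrow> \<tau> Y \<cdot>\<^bsub>D\<^esub> amap F f = amap G f \<cdot>\<^bsub>D\<^esub> \<tau> X"

locale monad =
  functor_between C C T +
  unit: natural_transformation C C id_functor T \<eta> +
  mult: natural_transformation C C "comp_functor T T" T \<mu>
  for C :: "('o, 'm, 'z) cat_scheme" (structure)
    and T :: "('o, 'm, 'o, 'm) functor_data" and \<eta> :: "'o \<Rightarrow> 'm" and \<mu> :: "'o \<Rightarrow> 'm" +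
  assumes left_unit: "X \<in> Obj C \<Longrightarrow> \<mu> X \<cdot> \<eta> (omap T X) = Ident C (omap T X)"
    and right_unit: "X \<in> Obj C \<Longrightarrow> \<mu> X \<cdot> amap T (\<eta> X) = Ident C (omap T X)"
    and mult_assoc: "X \<in> Obj C \<Longrightarrow> \<mu> X \<cdot> amap T (\<mu> X) = \<mu> X \<cdot> \<mu> (omap T X)"

locale monad_algebra = monad C T \<eta> \<mu>
  for C :: "('o, 'm, 'z) cat_scheme" (structure)
    and T :: "('o, 'm, 'o, 'm) functor_data" and \<eta> :: "'o \<Rightarrow> 'm" and \<mu> :: "'o \<Rightarrow> 'm" +
  fixes A :: 'o and e :: 'm
  assumes carrier_in_Obj: "A \<in> Obj C"
    and action_in_Hom: "e \<in> Hom C (omap T A) A"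
    and action_unit: "e \<cdot> \<eta> A = Ident C A"
    and action_mult: "e \<cdot> amap T e = e \<cdot> \<mu> A"

text \<open>The square with \<open>f : P \<rightarrow> X\<close>, \<open>g : P \<rightarrow> Y\<close>, \<open>m : X \<rightarrow> Z\<close>, \<open>n : Y \<rightarrow> Z\<close>; its corners are
  recovered from the arrows.\<close>

definition commuting_square ::
    "('o, 'm, 'z) cat_scheme \<Rightarrow> 'm \<Rightarrow> 'm \<Rightarrow> 'm \<Rightarrow> 'm \<Rightarrow> bool" where
  "commuting_square C f g m n \<longleftrightarrow>
     (\<exists>P X Y Z. f \<in> Hom C P X \<and> g \<in> Hom C P Y \<and> m \<in> Hom C X Z \<and> n \<in> Hom C Y Z) \<and>
     m \<cdot>\<^bsub>C\<^esub> f = n \<cdot>\<^bsub>C\<^esub> g"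

definition weak_pullback ::
    "('o, 'm, 'z) cat_scheme \<Rightarrow> 'm \<Rightarrow> 'm \<Rightarrow> 'm \<Rightarrow> 'm \<Rightarrow> bool" where
  "weak_pullback C f g m n \<longleftrightarrow>
     commuting_square C f g m n \<and>
     (\<forall>S \<in> Obj C. \<forall>b \<in> Hom C S (Cod C f). \<forall>c \<in> Hom C S (Cod C g).
        m \<cdot>\<^bsub>C\<^esub> b = n \<cdot>\<^bsub>C\<^esub> c \<longrightarrow>
        (\<exists>a \<in> Hom C S (Dom C f). f \<cdot>\<^bsub>C\<^esub> a = b \<and> g \<cdot>\<^bsub>C\<^esub> a = c))"

definition preserves_weak_pullbacks ::
    "('o, 'm, 'y) cat_scheme \<Rightarrow> ('p, 'n, 'z) cat_scheme \<Rightarrow>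
     ('o, 'm, 'p, 'n) functor_data \<Rightarrow> bool" where
  "preserves_weak_pullbacks C D F \<longleftrightarrow>
     (\<forall>f g m n. weak_pullback C f g m n \<longrightarrow>
        weak_pullback D (amap F f) (amap F g) (amap F m) (amap F n))"

definition weakly_cartesian_transformation ::
    "('o, 'm, 'y) cat_scheme \<Rightarrow> ('p, 'n, 'z) cat_scheme \<Rightarrow> ('o, 'm, 'p, 'n) functor_data \<Rightarrow>
     ('o, 'm, 'p, 'n) functor_data \<Rightarrow> ('o \<Rightarrow> 'n) \<Rightarrow> bool" where
  "weakly_cartesian_transformation C D F G \<tau> \<longleftrightarrow>
     (\<forall>X \<in> Obj C. \<forall>Y \<in> Obj C. \<forall>f \<in> Hom C X Y.
        weak_pullback D (amap F f) (\<tau> X) (\<tau> Y) (amap G f))"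

definition weakly_cartesian_monad ::
    "('o, 'm, 'z) cat_scheme \<Rightarrow> ('o, 'm, 'o, 'm) functor_data \<Rightarrow> ('o \<Rightarrow> 'm) \<Rightarrow> ('o \<Rightarrow> 'm) \<Rightarrow> bool"
  where
  "weakly_cartesian_monad C T \<eta> \<mu> \<longleftrightarrow>
     monad C T \<eta> \<mu> \<and>
     preserves_weak_pullbacks C C T \<and>
     weakly_cartesian_transformation C C id_functor T \<eta> \<and>
     weakly_cartesian_transformation C C (comp_functor T T) T \<mu>"

definition abstract_reduction_system :: "'a set \<Rightarrow> ('a \<times> 'a) set \<Rightarrow> bool" where
  "abstract_reduction_system X R \<longleftrightarrow> R \<subseteq> X \<times> X"

definition is_partial_evaluation ::
    "('o, 'm, 'z) cat_scheme \<Rightarrow> ('o, 'm, 'o, 'm) functor_data \<Rightarrow> ('o \<Rightarrow> 'm) \<Rightarrow>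
     'o \<Rightarrow> 'm \<Rightarrow> 'o \<Rightarrow> 'm \<Rightarrow> 'm \<Rightarrow> 'm \<Rightarrow> bool" where
  "is_partial_evaluation C T \<mu> A e S k p q \<longleftrightarrow>
     k \<in> Hom C S (omap T (omap T A)) \<and> \<mu> A \<cdot>\<^bsub>C\<^esub> k = p \<and> amap T e \<cdot>\<^bsub>C\<^esub> k = q"

definition partial_evaluation_rel ::
    "('o, 'm, 'z) cat_scheme \<Rightarrow> ('o, 'm, 'o, 'm) functor_data \<Rightarrow> ('o \<Rightarrow> 'm) \<Rightarrow>
     'o \<Rightarrow> 'm \<Rightarrow> 'o \<Rightarrow> ('m \<times> 'm) set" where
  "partial_evaluation_rel C T \<mu> A e S =
     {(p, q). p \<in> Hom C S (omap T A) \<and> q \<in> Hom C S (omap T A) \<and>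
        (\<exists>k. is_partial_evaluation C T \<mu> A e S k p q)}"

end

theory Submission
  imports Defs
begin

text \<open>A morphism \<open>p : S \<rightarrow> TA\<close> is a generalized formal expression with entries in \<open>A\<close>, \<open>e\<close> computes
  its total value, and a partial evaluation is a two-level bracketing \<open>k : S \<rightarrow> TTA\<close>: removing the
  brackets (\<open>\<mu>\<close>) gives the source, evaluating inside them (\<open>Te\<close>) gives the target.

  Two trivial bracketings always exist. Bracketing every entry alone, by \<open>T\<eta>\<close>, evaluates nothing,
  which gives reflexivity; bracketing the whole expression, by \<open>\<eta>\<close>, evaluates everything, so that
  every \<open>t\<close> reduces to its value \<open>\<eta> \<circ> e \<circ> t\<close> (\<open>reduces_to_value\<close>). By the associativity law
  \<open>e \<circ> Te = e \<circ> \<mu>\<close> of the algebra, a reduction cannot change the value (\<open>value_invariant\<close>). Hence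
  the value is a common reduct of any two reducts of \<open>s\<close>: this is confluence.

  For transitivity, let \<open>k\<close> witness \<open>p \<rightarrow> q\<close> and \<open>h\<close> witness \<open>q \<rightarrow> r\<close>. Then
  \<open>\<mu> \<circ> h = q = Te \<circ> k\<close>, so \<open>h\<close> and \<open>k\<close> form a cone over the naturality square of \<open>\<mu>\<close> at \<open>e\<close>. If
  that square is a weak pullback, the cone is induced by a three-level bracketing \<open>S \<rightarrow> TTTA\<close>;
  removing its innermost brackets, by \<open>T\<mu>\<close>, leaves a two-level bracketing that witnesses \<open>p \<rightarrow> r\<close>
  (\<open>partial_evaluations_compose\<close>).\<close>

context monad_algebra
begin

lemmas comp_Hom = source.Comp_in_Hom
lemmas assoc = source.Comp_assoc

lemma T_carrier_in_Obj: "omap T A \<in> Obj C"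
  using carrier_in_Obj by (rule omap_in_Obj)

lemma unit_in_Hom: "X \<in> Obj C \<Longrightarrow> \<eta> X \<in> Hom C X (omap T X)"
  using unit.component_in_Hom by (simp add: id_functor_def)

lemma mult_in_Hom: "X \<in> Obj C \<Longrightarrow> \<mu> X \<in> Hom C (omap T (omap T X)) (omap T X)"
  using mult.component_in_Hom by (simp add: comp_functor_def)

lemma T_action_in_Hom: "amap T e \<in> Hom C (omap T (omap T A)) (omap T A)"
  using action_in_Hom by (rule amap_in_Hom)

lemma unit_natural: "f \<in> Hom C X Y \<Longrightarrow> \<eta> Y \<cdot> f = amap T f \<cdot> \<eta> X"
  using unit.naturality by (simp add: id_functor_def)

lemma reduces_to_self:
  assumes "s \<in> Hom C S (omap T A)"
  shows "(s, s) \<in> partial_evaluation_rel C T \<mu> A e S"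
proof -
  let ?k = "amap T (\<eta> A) \<cdot> s"
  have T\<eta>: "amap T (\<eta> A) \<in> Hom C (omap T A) (omap T (omap T A))"
    using carrier_in_Obj by (intro amap_in_Hom unit_in_Hom)
  have "\<mu> A \<cdot> ?k = s"
    using assoc[OF assms T\<eta> mult_in_Hom[OF carrier_in_Obj]]
    by (simp add: right_unit carrier_in_Obj source.Ident_Comp[OF assms])
  moreover have "amap T e \<cdot> amap T (\<eta> A) = Ident C (omap T A)"
    using amap_Comp[OF unit_in_Hom[OF carrier_in_Obj] action_in_Hom]
    by (simp add: action_unit amap_Ident carrier_in_Obj)
  hence "amap T e \<cdot> ?k = s"
    using assoc[OF assms T\<eta> T_action_in_Hom] by (simp add: source.Ident_Comp[OF assms])
  ultimately show ?thesis
    using assms comp_Hom[OF assms T\<eta>]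
    by (auto simp: partial_evaluation_rel_def is_partial_evaluation_def)
qed

lemma value_in_Hom:
  assumes "t \<in> Hom C S (omap T A)"
  shows "\<eta> A \<cdot> e \<cdot> t \<in> Hom C S (omap T A)"
  using assms action_in_Hom unit_in_Hom[OF carrier_in_Obj] by (blast intro: comp_Hom)

text \<open>The witness is the outer bracketing \<open>\<eta>\<close>; naturality of \<open>\<eta>\<close> at \<open>e\<close> says that evaluating inside
  the one outer bracket yields the total value as a trivial expression.\<close>

lemma reduces_to_value:
  assumes "t \<in> Hom C S (omap T A)"
  shows "(t, \<eta> A \<cdot> e \<cdot> t) \<in> partial_evaluation_rel C T \<mu> A e S"
proof -
  let ?k = "\<eta> (omap T A) \<cdot> t"
  note \<eta>T = unit_in_Hom[OF T_carrier_in_Obj]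
  have "\<mu> A \<cdot> ?k = t"
    using assoc[OF assms \<eta>T mult_in_Hom[OF carrier_in_Obj]]
    by (simp add: left_unit carrier_in_Obj source.Ident_Comp[OF assms])
  moreover have "amap T e \<cdot> ?k = \<eta> A \<cdot> e \<cdot> t"
    using assoc[OF assms \<eta>T T_action_in_Hom]
      assoc[OF assms action_in_Hom unit_in_Hom[OF carrier_in_Obj]]
    by (simp add: unit_natural[OF action_in_Hom])
  ultimately show ?thesis
    using assms value_in_Hom[OF assms] comp_Hom[OF assms \<eta>T]
    by (auto simp: partial_evaluation_rel_def is_partial_evaluation_def)
qed

text \<open>Both sides are the total value of the two-level expression that witnesses the reduction,
  computed in two ways that agree by \<open>e \<circ> Te = e \<circ> \<mu>\<close>.\<close>

lemma value_invariant:
  assumes "(s, t) \<in> partial_evaluation_rel C T \<mu> A e S"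
  shows "e \<cdot> t = e \<cdot> s"
proof -
  obtain k where k: "k \<in> Hom C S (omap T (omap T A))"
    and s: "s = \<mu> A \<cdot> k" and t: "t = amap T e \<cdot> k"
    using assms by (auto simp: partial_evaluation_rel_def is_partial_evaluation_def)
  have "e \<cdot> t = (e \<cdot> amap T e) \<cdot> k"
    unfolding t using assoc[OF k T_action_in_Hom action_in_Hom] by simp
  also have "\<dots> = e \<cdot> s"
    unfolding s action_mult using assoc[OF k mult_in_Hom[OF carrier_in_Obj] action_in_Hom] by simp
  finally show ?thesis .
qed

text \<open>The hypothesis on the naturality square at \<open>e\<close> provides a three-level bracketing \<open>a\<close> that
  becomes \<open>h\<close> when its innermost level is evaluated and \<open>k\<close> when its outer two levels are merged.
  For \<open>l = T\<mu> \<circ> a\<close>, monad associativity turns \<open>\<mu> \<circ> l\<close> into \<open>\<mu> \<circ> k\<close>, and algebra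
  associativity, under \<open>T\<close>, turns \<open>Te \<circ> l\<close> into \<open>Te \<circ> h\<close>.\<close>

lemma partial_evaluations_compose:
  assumes wpb: "weak_pullback C (amap T (amap T e)) (\<mu> (omap T A)) (\<mu> A) (amap T e)"
    and pq: "(p, q) \<in> partial_evaluation_rel C T \<mu> A e S"
    and qr: "(q, r) \<in> partial_evaluation_rel C T \<mu> A e S"
  shows "(p, r) \<in> partial_evaluation_rel C T \<mu> A e S"
proof -
  obtain k where k: "k \<in> Hom C S (omap T (omap T A))"
    and p: "p = \<mu> A \<cdot> k" and q: "q = amap T e \<cdot> k"
    using pq by (auto simp: partial_evaluation_rel_def is_partial_evaluation_def)
  obtain h where h: "h \<in> Hom C S (omap T (omap T A))"
    and q': "q = \<mu> A \<cdot> h" and r: "r = amap T e \<cdot> h"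
    using qr by (auto simp: partial_evaluation_rel_def is_partial_evaluation_def)
  note \<mu>A = mult_in_Hom[OF carrier_in_Obj] and \<mu>TA = mult_in_Hom[OF T_carrier_in_Obj]
  note TTe = amap_in_Hom[OF T_action_in_Hom] and T\<mu> = amap_in_Hom[OF \<mu>A]
  have "S \<in> Obj C"
    using k source.Dom_in_Obj by (auto simp: Hom_def)
  moreover have "Cod C (amap T (amap T e)) = omap T (omap T A)"
    "Dom C (amap T (amap T e)) = omap T (omap T (omap T A))"
    "Cod C (\<mu> (omap T A)) = omap T (omap T A)"
    using TTe \<mu>TA by (auto simp: Hom_def)
  ultimately obtain a where a: "a \<in> Hom C S (omap T (omap T (omap T A)))"
    and ah: "amap T (amap T e) \<cdot> a = h" and ak: "\<mu> (omap T A) \<cdot> a = k"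
    using wpb h k q q' unfolding weak_pullback_def by metis
  let ?l = "amap T (\<mu> A) \<cdot> a"
  have "\<mu> A \<cdot> ?l = p"
    using assoc[OF a T\<mu> \<mu>A] assoc[OF a \<mu>TA \<mu>A] by (simp add: mult_assoc carrier_in_Obj ak p)
  moreover have "amap T e \<cdot> amap T (\<mu> A) = amap T e \<cdot> amap T (amap T e)"
    using amap_Comp[OF \<mu>A action_in_Hom] amap_Comp[OF T_action_in_Hom action_in_Hom]
    by (simp add: action_mult)
  hence "amap T e \<cdot> ?l = r"
    using assoc[OF a T\<mu> T_action_in_Hom] assoc[OF a TTe T_action_in_Hom] by (simp add: ah r)
  ultimately show ?thesis
    using pq qr comp_Hom[OF a T\<mu>]
    by (auto simp: partial_evaluation_rel_def is_partial_evaluation_def)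
qed

lemma weakly_cartesian_imp_trans:
  assumes "weakly_cartesian_monad C T \<eta> \<mu>"
  shows "trans (partial_evaluation_rel C T \<mu> A e S)"
proof -
  have "weak_pullback C (amap T (amap T e)) (\<mu> (omap T A)) (\<mu> A) (amap T e)"
    using assms carrier_in_Obj T_carrier_in_Obj action_in_Hom
    by (auto simp: weakly_cartesian_monad_def weakly_cartesian_transformation_def
        comp_functor_def)
  thus ?thesis
    by (intro transI) (rule partial_evaluations_compose)
qed

end

theorem proposition4p1:
  fixes C :: "('o, 'm, 'z) cat_scheme" (structure)
    and T :: "('o, 'm, 'o, 'm) functor_data"
    and \<eta> \<mu> :: "'o \<Rightarrow> 'm" and A S :: 'o and e :: 'm
  assumes "monad C T \<eta> \<mu>"
    and "monad_algebra C T \<eta> \<mu> A e"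
    and "S \<in> Obj C"
  defines "H \<equiv> Hom C S (omap T A)"
    and "R \<equiv> partial_evaluation_rel C T \<mu> A e S"
  shows "abstract_reduction_system H R
    \<and> (\<forall>s \<in> H. (s, s) \<in> R)
    \<and> (\<forall>s \<in> H. \<forall>t \<in> H. \<forall>u \<in> H. (s, t) \<in> R \<and> (s, u) \<in> R \<longrightarrow>
          (\<exists>z \<in> H. (t, z) \<in> R \<and> (u, z) \<in> R)
          \<and> \<eta> A \<cdot> e \<cdot> t \<in> H
          \<and> \<eta> A \<cdot> e \<cdot> t = \<eta> A \<cdot> e \<cdot> u
          \<and> (t, \<eta> A \<cdot> e \<cdot> t) \<in> R \<and> (u, \<eta> A \<cdot> e \<cdot> t) \<in> R)
    \<and> (weakly_cartesian_monad C T \<eta> \<mu> \<longrightarrow> trans R)"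
proof -
  interpret monad_algebra C T \<eta> \<mu> A e by fact
  have "abstract_reduction_system H R"
    by (auto simp: abstract_reduction_system_def H_def R_def partial_evaluation_rel_def)
  moreover have "\<forall>s \<in> H. (s, s) \<in> R"
    unfolding H_def R_def using reduces_to_self by blast
  moreover have "(\<exists>z \<in> H. (t, z) \<in> R \<and> (u, z) \<in> R)
      \<and> \<eta> A \<cdot> e \<cdot> t \<in> H \<and> \<eta> A \<cdot> e \<cdot> t = \<eta> A \<cdot> e \<cdot> u
      \<and> (t, \<eta> A \<cdot> e \<cdot> t) \<in> R \<and> (u, \<eta> A \<cdot> e \<cdot> t) \<in> R"
    if "t \<in> H" "u \<in> H" "(s, t) \<in> R" "(s, u) \<in> R" for s t u
  proof -
    have eq: "\<eta> A \<cdot> e \<cdot> t = \<eta> A \<cdot> e \<cdot> u"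
      using that value_invariant unfolding R_def by metis
    have "\<eta> A \<cdot> e \<cdot> t \<in> H" "(t, \<eta> A \<cdot> e \<cdot> t) \<in> R" "(u, \<eta> A \<cdot> e \<cdot> u) \<in> R"
      using that value_in_Hom reduces_to_value unfolding H_def R_def by blast+
    with eq show ?thesis by metis
  qed
  moreover have "weakly_cartesian_monad C T \<eta> \<mu> \<longrightarrow> trans R"
    unfolding R_def using weakly_cartesian_imp_trans by blast
  ultimately show ?thesis by blast
qed

end
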